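(* Let $\Theta$ and $\mathcal C$ be the polyhedra $\Theta=\{x\in\mathbb R^n\mid \langle a_i,x\rangle\le b_i\ \forall i\in I_1\}$ and $\mathcal C=\{x\in\mathbb R^n\mid \langle a_i,x\rangle\le 0\ \forall i\in I_2\}$, and let $\mathcal N$ be the normal cone mapping to $\Theta$. Let $\bar x\in\mathcal C$ and $(\bar x,\bar x^* )\in\operatorname{gph}\mathcal N$, and put $\bar I:=I(\bar x)$. Then the limiting coderivative with respect to $\mathcal C$ of $\mathcal N$ at $(\bar x,\bar x^* )$ is given, for all $u\in\mathbb R^n$, by $$D^*_{\mathcal C}\mathcal N(\bar x,\bar x^* )(u)=\Big\{v\ \Big|\ (v,-u)\in(A_{Q,P}\cap\mathcal T_{Q|_{I_2}})\times B_{Q|_{I_1},P}\ \text{for some } Q\subset\bar I,\ P\in\mathcal P(\bar x,\bar x^* )\text{ with } C_Q\neq\emptyset,\ P\subset Q|_{I_1}\Big\}.$$ If, in addition, the generating vectors $a_i$, $i\in I(\bar x)$, are linearly independent, then for all $u\in\mathbb R^n$ $$D^*_{\mathcal C}\mathcal N(\bar x,\bar x^* )(u)=\Big\{v\ \Big|\ (v,-u)\in(A_{Q,P}\cap\mathcal T_{Q|_{I_2}})\times B_{Q|_{I_1},P}\ \text{for some } Q\subset\bar I\text{ and }P\text{ with }\mathcal I(\bar x,\bar x^* )\subset P\subset Q|_{I_1}\Big\}.$$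
   Context: Setting: $I_1=\{1,\dots,\ell_1\}$, $I_2=\{\ell_1+1,\dots,\ell\}$, $I=I_1\cup I_2$; $a_i\in\mathbb R^n$ for $i\in I$, $b_i\in\mathbb R$ for $i\in I_1$. Active index sets: $I_1(x)=\{i\in I_1\mid\langle a_i,x\rangle=b_i\}$ for $x\in\Theta$; $I_2(x)=\{i\in I_2\mid\langle a_i,x\rangle=0\}$ for $x\in\mathcal C$; $I(x)=I_1(x)\cup I_2(x)$ for $x\in\Theta\cap\mathcal C$. Normal cone mapping: $\mathcal N(x)=N(x,\Theta)$ (the usual normal cone to the convex set $\Theta$, equal to $\operatorname{cone}\{a_i\mid i\in I_1(x)\}$) if $x\in\Theta$, and $\mathcal N(x)=\emptyset$ otherwise; $\operatorname{gph}\mathcal N=\{(x,x^* )\mid x^*\in\mathcal N(x)\}$. Index set $\mathcal I(\bar x,\bar x^* )$: since $\bar x^*\in N(\bar x,\Theta)$, there are a set $\mathcal I\subset I_1(\bar x)$ and numbers $\lambda_i\ge 0$ ($i\in\mathcal I$) with $\bar x^*=\sum_{i\in\mathcal I}\lambda_ia_i$; fixing such a representation, $\mathcal I(\bar x,\bar x^* ):=\{i\in\mathcal I\mid\lambda_i>0\}$. For $Q\subset I$: $Q|_{I_j}=Q\cap I_j$ ($j=1,2$), $\mathcal T_Q=\{u\in\mathbb R^n\mid\langle a_i,u\rangle\le 0\ \forall i\in Q\}$, and $C_Q=\{x\in\mathbb R^n\mid\langle a_i,x\rangle=0\ \forall i\in Q,\ \langle a_i,x\rangle<0\ \forall i\in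 I\setminus Q\}$. For $P\subset Q\subset I$ with $P\subset I_1$: $B_{Q,P}=\{u\in\mathcal T_Q\mid\langle a_i,u\rangle=0\ \forall i\in P\}$, $A_{Q,P}=\operatorname{cone}\{a_i\mid i\in Q\setminus P\}+\operatorname{span}\{a_i\mid i\in P\}$. Also $\mathcal P(\bar x,\bar x^* )=\{P\subset I_1(\bar x)\mid\bar x^*\in\operatorname{cone}\{a_i\mid i\in P\}\}$. Here $\operatorname{cone}$ is the convex cone generated (nonnegative combinations), $\operatorname{cone}\emptyset=\operatorname{span}\emptyset=\{0\}$, $\mathcal T_\emptyset=\mathbb R^n$. Normal cones with respect to a set: for nonempty $\Omega,\mathcal D\subset\mathbb R^s$ with $\mathcal D$ closed and convex, and $\bar z\in\Omega\cap\mathcal D$, $$\hat N_{\mathcal D}(\bar z,\Omega)=\Big\{z^*\ \Big|\ \exists p>0:\ \bar z+pz^*\in\mathcal D,\ \limsup_{z\to\bar z,\ z\in\Omega\cap\mathcal D}\frac{\langle z^*,z-\bar z\rangle}{\|z-\bar z\|}\le 0\Big\},$$ and $N_{\mathcal D}(\bar z,\Omega)$ is the set of all $z^*$ for which there exist $z_k\to\bar z$ with $z_k\in\Omega\cap\mathcal D$ and $z_k^*\to z^*$ with $z_k^*\in\hat N_{\mathcal D}(z_k,\Omega)$. Limiting coderivative with respect to $\mathcal C$ of $F:\mathbb R^n\rightrightarrows\mathbb R^m$ at $(\bar x,\bar y)\in\operatorname{gph}F$, $\bar x\in\mathcal C$: $D^*_{\mathcal C}F(\bar x,\bar y)(y^*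 )=\{x^*\in\mathbb R^n\mid(x^*,-y^* )\in N_{\mathcal C\times\mathbb R^m}((\bar x,\bar y),\operatorname{gph}F_{\mathcal C})\}$, where $\operatorname{gph}F_{\mathcal C}=\operatorname{gph}F\cap(\mathcal C\times\mathbb R^m)$.
   Formalization: In the first formula, C_Q is taken with strict inequalities only for i in I(x̄)\Q rather than I\Q; with I\Q the formula fails, e.g. for Θ=[-1,0], C=R, x̄=x̄*=0, where the right side is empty but 0 belongs to the coderivative at 0. *)

theory Defs
  imports "HOL-Analysis.Analysis"
begin

section \<open>Normal cones and coderivatives with respect to a set\<close>

definition gph :: "('a \<Rightarrow> 'b set) \<Rightarrow> ('a \<times> 'b) set" where
  "gph F = {(x, y). y \<in> F x}"

text \<open>
  The quotient is taken in the extended reals so that the upper limit always exists. The filter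
  excludes the base point itself; at an isolated point of \<open>\<Omega> \<inter> D\<close> the upper limit is \<open>-\<infinity>\<close>.
\<close>

definition regular_normal_wrt :: "'a::euclidean_space set \<Rightarrow> 'a \<Rightarrow> 'a set \<Rightarrow> 'a set" where
  "regular_normal_wrt D z \<Omega> =
     {zs. (\<exists>p>0. z + p *\<^sub>R zs \<in> D) \<and>
          Limsup (at z within (\<Omega> \<inter> D)) (\<lambda>y. ereal (zs \<bullet> (y - z) / norm (y - z))) \<le> 0}"

definition limiting_normal_wrt :: "'a::euclidean_space set \<Rightarrow> 'a \<Rightarrow> 'a set \<Rightarrow> 'a set" where
  "limiting_normal_wrt D z \<Omega> =
     {zs. \<exists>(y :: nat \<Rightarrow> 'a) ys. y \<longlonglongrightarrow> z \<and> ys \<longlonglongrightarrow> zs \<and>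
          (\<forall>k. y k \<in> \<Omega> \<inter> D \<and> ys k \<in> regular_normal_wrt D (y k) \<Omega>)}"

definition limiting_coderivative_wrt ::
  "'a::euclidean_space set \<Rightarrow> ('a \<Rightarrow> 'b::euclidean_space set) \<Rightarrow> 'a \<Rightarrow> 'b \<Rightarrow> 'b \<Rightarrow> 'a set" where
  "limiting_coderivative_wrt C F x y ys =
     {xs. (xs, - ys) \<in> limiting_normal_wrt (C \<times> UNIV) (x, y) (gph F \<inter> (C \<times> UNIV))}"

definition convex_normal_cone :: "'a::euclidean_space \<Rightarrow> 'a set \<Rightarrow> 'a set" where
  "convex_normal_cone x \<Theta> = {xs. \<forall>y\<in>\<Theta>. xs \<bullet> (y - x) \<le> 0}"

definition normal_cone_map :: "'a::euclidean_space set \<Rightarrow> 'a \<Rightarrow> 'a set" where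
  "normal_cone_map \<Theta> x = (if x \<in> \<Theta> then convex_normal_cone x \<Theta> else {})"


section \<open>The polyhedral data\<close>

definition idx1 :: "nat \<Rightarrow> nat set" where
  "idx1 l1 = {1..l1}"

definition idx2 :: "nat \<Rightarrow> nat \<Rightarrow> nat set" where
  "idx2 l1 l = {l1 + 1..l}"

definition poly_Theta :: "(nat \<Rightarrow> 'a::euclidean_space) \<Rightarrow> (nat \<Rightarrow> real) \<Rightarrow> nat \<Rightarrow> 'a set" where
  "poly_Theta a b l1 = {x. \<forall>i\<in>idx1 l1. a i \<bullet> x \<le> b i}"

definition poly_C :: "(nat \<Rightarrow> 'a::euclidean_space) \<Rightarrow> nat \<Rightarrow> nat \<Rightarrow> 'a set" where
  "poly_C a l1 l = {x. \<forall>i\<in>idx2 l1 l. a i \<bullet> x \<le> 0}"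

definition active1 :: "(nat \<Rightarrow> 'a::euclidean_space) \<Rightarrow> (nat \<Rightarrow> real) \<Rightarrow> nat \<Rightarrow> 'a \<Rightarrow> nat set" where
  "active1 a b l1 x = {i \<in> idx1 l1. a i \<bullet> x = b i}"

definition active2 :: "(nat \<Rightarrow> 'a::euclidean_space) \<Rightarrow> nat \<Rightarrow> nat \<Rightarrow> 'a \<Rightarrow> nat set" where
  "active2 a l1 l x = {i \<in> idx2 l1 l. a i \<bullet> x = 0}"

definition active ::
  "(nat \<Rightarrow> 'a::euclidean_space) \<Rightarrow> (nat \<Rightarrow> real) \<Rightarrow> nat \<Rightarrow> nat \<Rightarrow> 'a \<Rightarrow> nat set" where
  "active a b l1 l x = active1 a b l1 x \<union> active2 a l1 l x"

definition T_set :: "(nat \<Rightarrow> 'a::euclidean_space) \<Rightarrow> nat set \<Rightarrow> 'a set" where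
  "T_set a Q = {u. \<forall>i\<in>Q. a i \<bullet> u \<le> 0}"

text \<open>
  The ambient index set \<open>J\<close> of \<open>C\<^sub>Q\<close> is a parameter. In the coderivative formula it has to be the
  set of constraints active at the reference point: there \<open>C\<^sub>Q \<noteq> \<emptyset>\<close> expresses that \<open>Q\<close> is the
  active set of points of \<open>\<Theta> \<inter> C\<close> arbitrarily close to the reference point, and an inactive
  constraint imposes no sign condition on a direction.
\<close>

definition C_set :: "(nat \<Rightarrow> 'a::euclidean_space) \<Rightarrow> nat set \<Rightarrow> nat set \<Rightarrow> 'a set" where
  "C_set a J Q = {x. (\<forall>i\<in>Q. a i \<bullet> x = 0) \<and> (\<forall>i\<in>J - Q. a i \<bullet> x < 0)}"

definition B_set :: "(nat \<Rightarrow> 'a::euclidean_space) \<Rightarrow> nat set \<Rightarrow> nat set \<Rightarrow> 'a set" where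
  "B_set a Q P = {u \<in> T_set a Q. \<forall>i\<in>P. a i \<bullet> u = 0}"

definition A_set :: "(nat \<Rightarrow> 'a::euclidean_space) \<Rightarrow> nat set \<Rightarrow> nat set \<Rightarrow> 'a set" where
  "A_set a Q P = {v + w | v w. v \<in> convex_cone hull (a ` (Q - P)) \<and> w \<in> span (a ` P)}"

definition P_sets ::
  "(nat \<Rightarrow> 'a::euclidean_space) \<Rightarrow> (nat \<Rightarrow> real) \<Rightarrow> nat \<Rightarrow> 'a \<Rightarrow> 'a \<Rightarrow> nat set set" where
  "P_sets a b l1 x xs = {P. P \<subseteq> active1 a b l1 x \<and> xs \<in> convex_cone hull (a ` P)}"

text \<open>Linear independence of the indexed family, so repeated vectors count as dependent.\<close>

definition independent_family :: "('i \<Rightarrow> 'a::real_vector) \<Rightarrow> 'i set \<Rightarrow> bool" where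
  "independent_family a J \<longleftrightarrow> inj_on a J \<and> independent (a ` J)"

text \<open>\<open>xs = \<Sum>i\<in>J. lam i *\<^sub>R a i\<close> is a representation of \<open>xs\<close> by active generators of \<open>\<Theta>\<close> at \<open>x\<close>.\<close>

definition normal_representation ::
  "(nat \<Rightarrow> 'a::euclidean_space) \<Rightarrow> (nat \<Rightarrow> real) \<Rightarrow> nat \<Rightarrow> 'a \<Rightarrow> 'a \<Rightarrow>
     nat set \<Rightarrow> (nat \<Rightarrow> real) \<Rightarrow> bool" where
  "normal_representation a b l1 x xs J lam \<longleftrightarrow>
     J \<subseteq> active1 a b l1 x \<and> (\<forall>i\<in>J. lam i \<ge> 0) \<and> xs = (\<Sum>i\<in>J. lam i *\<^sub>R a i)"

definition positive_idx :: "nat set \<Rightarrow> (nat \<Rightarrow> real) \<Rightarrow> nat set" where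
  "positive_idx J lam = {i \<in> J. lam i > 0}"

end

theory Submission
  imports Defs
begin

text \<open>
  At a graph point \<open>(y, ys)\<close> write \<open>ys\<close> as a combination of active generators with strictly positive
  coefficients on \<open>P\<close>. Since the finitely many cones spanned by generators are closed, \<open>ys\<close> remains
  normal to \<open>\<Theta>\<close> at every \<open>y'\<close> occurring in a nearby graph point \<open>(y', ys')\<close>, and this forces all
  constraints in \<open>P\<close> to stay active at \<open>y'\<close>. Hence the regular normals depend only on \<open>P\<close> and on the
  active set \<open>Q\<close> of \<open>y\<close>, and Farkas' lemma identifies them as \<open>(A \<inter> T) \<times> B\<close>. As there are finitely
  many pairs \<open>(Q, P)\<close>, every limiting normal arises along a sequence with a constant pair, and the
  products are closed. Conversely, a pair \<open>(Q, P)\<close> is realised along \<open>x + t d\<close> with \<open>d \<in> C\<^sub>Q\<close> and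
  \<open>xs + t (\<Sum>i\<in>P. a i)\<close> as \<open>t\<close> tends to \<open>0\<close> from the right.
\<close>

section \<open>Finitely generated cones and Farkas' lemma\<close>

text \<open>Coefficients are attached to indices rather than to vectors, so repeated generators need
  no care. The nonnegative combinations form a convex cone containing the generators, and induction
  on \<open>S\<close> puts them back into the hull.\<close>

lemma convex_cone_hull_image_finite:
  fixes a :: "'i \<Rightarrow> 'a::real_vector"
  assumes "finite S"
  shows "convex_cone hull (a ` S) = {\<Sum>i\<in>S. c i *\<^sub>R a i | c. \<forall>i\<in>S. c i \<ge> 0}" (is "_ = ?R")
proof
  show "convex_cone hull (a ` S) \<subseteq> ?R"
  proof (rule hull_minimal)
    show "a ` S \<subseteq> ?R"
    proof clarify
      fix i assume "i \<in> S"
      then have "a i = (\<Sum>j\<in>S. (if j = i then 1 else 0) *\<^sub>R a j)"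
        using assms by (simp add: if_distrib[of "\<lambda>c. c *\<^sub>R _"] cong: if_cong)
      then show "\<exists>c. a i = (\<Sum>j\<in>S. c j *\<^sub>R a j) \<and> (\<forall>j\<in>S. c j \<ge> 0)"
        by (intro exI[of _ "\<lambda>j. if j = i then 1 else 0"]) simp
    qed
    show "convex_cone ?R"
      unfolding convex_cone_iff
    proof (intro conjI ballI allI impI)
      show "0 \<in> ?R"
        by (intro CollectI exI[of _ "\<lambda>_. 0"]) simp
    next
      fix x y assume "x \<in> ?R" "y \<in> ?R"
      then obtain c d where "x = (\<Sum>i\<in>S. c i *\<^sub>R a i)" "y = (\<Sum>i\<in>S. d i *\<^sub>R a i)"
        "\<forall>i\<in>S. c i \<ge> 0" "\<forall>i\<in>S. d i \<ge> 0" by blast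
      then show "x + y \<in> ?R"
        by (intro CollectI exI[of _ "\<lambda>i. c i + d i"]) (simp add: scaleR_left_distrib sum.distrib)
    next
      fix x and t :: real assume "x \<in> ?R" "t \<ge> 0"
      then obtain c where "x = (\<Sum>i\<in>S. c i *\<^sub>R a i)" "\<forall>i\<in>S. c i \<ge> 0" by blast
      with \<open>t \<ge> 0\<close> show "t *\<^sub>R x \<in> ?R"
        by (intro CollectI exI[of _ "\<lambda>i. t * c i"]) (simp add: scaleR_right.sum)
    qed
  qed
  show "?R \<subseteq> convex_cone hull (a ` S)"
  proof clarify
    fix c :: "'i \<Rightarrow> real" assume "\<forall>i\<in>S. c i \<ge> 0"
    with assms show "(\<Sum>i\<in>S. c i *\<^sub>R a i) \<in> convex_cone hull (a ` S)"
    proof (induction S rule: finite_induct)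
      case (insert i S)
      have "(\<Sum>i\<in>S. c i *\<^sub>R a i) \<in> convex_cone hull (a ` insert i S)"
        using insert hull_mono[of "a ` S" "a ` insert i S" convex_cone] by auto
      moreover have "c i *\<^sub>R a i \<in> convex_cone hull (a ` insert i S)"
        using insert.prems by (intro convex_cone_hull_mul hull_inc) auto
      ultimately show ?case
        using insert.hyps by (simp add: convex_cone_hull_add)
    qed (simp add: convex_cone_hull_contains_0)
  qed
qed

lemma sum_in_convex_cone_hull_image:
  fixes a :: "'i \<Rightarrow> 'a::real_vector"
  assumes "finite P" and "P \<subseteq> S" and "\<And>i. i \<in> P \<Longrightarrow> c i \<ge> 0"
  shows "(\<Sum>i\<in>P. c i *\<^sub>R a i) \<in> convex_cone hull (a ` S)"
proof -
  have "(\<Sum>i\<in>P. c i *\<^sub>R a i) \<in> convex_cone hull (a ` P)"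
    unfolding convex_cone_hull_image_finite[OF assms(1)] using assms(3) by blast
  then show ?thesis
    using hull_mono[of "a ` P" "a ` S" convex_cone] assms(2) by blast
qed

lemma convex_cone_hull_positive_combination:
  fixes a :: "'i \<Rightarrow> 'a::real_vector"
  assumes "finite S" and "x \<in> convex_cone hull (a ` S)"
  obtains P c where "P \<subseteq> S" "\<And>i. i \<in> P \<Longrightarrow> c i > 0" "x = (\<Sum>i\<in>P. c i *\<^sub>R a i)"
proof -
  obtain c where c: "x = (\<Sum>i\<in>S. c i *\<^sub>R a i)" "\<forall>i\<in>S. c i \<ge> 0"
    using assms by (auto simp: convex_cone_hull_image_finite)
  have "x = (\<Sum>i\<in>{i\<in>S. c i > 0}. c i *\<^sub>R a i)"
    unfolding c(1) using assms(1) c(2) by (intro sum.mono_neutral_right) (auto simp: order.order_iff_strict)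
  then show thesis
    by (intro that[of "{i\<in>S. c i > 0}" c]) auto
qed

text \<open>Finitely generated cones are polyhedral, hence closed, so a point outside the cone can
  be strictly separated from it. The negated normal \<open>- w\<close> of the separating hyperplane
  then violates the assumption on \<open>v\<close>.\<close>

lemma farkas:
  fixes S :: "'a::euclidean_space set"
  assumes "finite S" and polar: "\<And>d. (\<And>s. s \<in> S \<Longrightarrow> s \<bullet> d \<le> 0) \<Longrightarrow> v \<bullet> d \<le> 0"
  shows "v \<in> convex_cone hull S"
proof (rule ccontr)
  assume "v \<notin> convex_cone hull S"
  moreover have "closed (convex_cone hull S)"
    using assms(1) by (intro polyhedron_imp_closed polyhedron_convex_cone_hull)
  ultimately obtain w \<beta> where w: "w \<bullet> v < \<beta>" "\<And>s. s \<in> convex_cone hull S \<Longrightarrow> w \<bullet> s > \<beta>"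
    using separating_hyperplane_closed_point[OF convex_convex_cone_hull] by metis
  have "\<beta> < 0"
    using w(2)[OF convex_cone_hull_contains_0] by simp
  have "s \<bullet> (- w) \<le> 0" if "s \<in> S" for s
  proof (rule ccontr)
    assume "\<not> s \<bullet> (- w) \<le> 0"
    then have neg: "w \<bullet> s < 0" by (simp add: inner_commute)
    \<comment> \<open>The factor is chosen so that \<open>w\<close> takes exactly the value
      \<open>\<beta>\<close> at the scaled vector, which contradicts the strict separation. It is
      nonnegative because both numbers are negative.\<close>
    have "(\<beta> / (w \<bullet> s)) *\<^sub>R s \<in> convex_cone hull S"
      using that neg \<open>\<beta> < 0\<close> by (intro convex_cone_hull_mul hull_inc) (auto simp: divide_nonpos_neg)
    from w(2)[OF this] neg show False by simp
  qed
  then have "v \<bullet> (- w) \<le> 0" by (rule polar)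
  with w(1) \<open>\<beta> < 0\<close> show False by (simp add: inner_commute)
qed

lemma inner_convex_cone_hull_nonpos:
  assumes "v \<in> convex_cone hull S" and "\<And>s. s \<in> S \<Longrightarrow> s \<bullet> d \<le> 0"
  shows "v \<bullet> d \<le> 0"
proof -
  have "convex_cone hull S \<subseteq> {s. d \<bullet> s \<le> 0}"
    using assms(2) by (intro hull_minimal convex_cone_halfspace_le) (auto simp: inner_commute)
  with assms(1) show ?thesis by (auto simp: inner_commute)
qed

text \<open>This is the bipolar theorem for the cone \<open>A_set\<close>, whose polar is
  \<open>B_set\<close>. It turns membership in \<open>A_set\<close> into a test against directions,
  the form in which regular normals appear, and it also yields closedness.\<close>

lemma A_set_iff_polar:
  fixes a :: "nat \<Rightarrow> 'a::euclidean_space"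
  assumes "finite Q" and "P \<subseteq> Q"
  shows "v \<in> A_set a Q P \<longleftrightarrow> (\<forall>d\<in>B_set a Q P. v \<bullet> d \<le> 0)"
proof
  assume "v \<in> A_set a Q P"
  then obtain p q where v: "v = p + q" "p \<in> convex_cone hull (a ` (Q - P))" "q \<in> span (a ` P)"
    unfolding A_set_def by blast
  show "\<forall>d\<in>B_set a Q P. v \<bullet> d \<le> 0"
  proof
    fix d assume d: "d \<in> B_set a Q P"
    have "p \<bullet> d \<le> 0"
      using v(2) by (rule inner_convex_cone_hull_nonpos) (use d in \<open>auto simp: B_set_def T_set_def\<close>)
    moreover have "d \<bullet> q = 0"
      using v(3) by (rule orthogonal_to_span[unfolded orthogonal_def])
        (use d in \<open>auto simp: B_set_def inner_commute\<close>)
    ultimately show "v \<bullet> d \<le> 0"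
      by (simp add: v(1) inner_add_left inner_commute[of q])
  qed
next
  assume polar: "\<forall>d\<in>B_set a Q P. v \<bullet> d \<le> 0"
  \<comment> \<open>With the negatives of the generators in \<open>P\<close> adjoined, the equations
    in \<open>B_set\<close> become pairs of inequalities and the span becomes part of a finitely
    generated cone, so Farkas' lemma applies.\<close>
  let ?S = "a ` P \<union> uminus ` a ` P"
  have "v \<in> convex_cone hull (a ` (Q - P) \<union> ?S)"
  proof (rule farkas)
    have "finite P" using assms finite_subset by blast
    then show "finite (a ` (Q - P) \<union> ?S)" using assms by simp
  next
    fix d assume d: "\<And>s. s \<in> a ` (Q - P) \<union> ?S \<Longrightarrow> s \<bullet> d \<le> 0"
    have eq: "a i \<bullet> d = 0" if "i \<in> P" for i
      using d[of "a i"] d[of "- a i"] that by auto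
    have "a i \<bullet> d \<le> 0" if "i \<in> Q" for i
      using d[of "a i"] that by (cases "i \<in> P") auto
    with eq have "d \<in> B_set a Q P" by (auto simp: B_set_def T_set_def)
    with polar show "v \<bullet> d \<le> 0" by blast
  qed
  moreover have "convex_cone hull ?S \<subseteq> span (a ` P)"
    by (intro hull_minimal convex_cone_span) (auto intro: span_base span_neg)
  ultimately show "v \<in> A_set a Q P"
    unfolding convex_cone_hull_Un A_set_def by blast
qed

section \<open>Feasible directions and criteria for regular normals\<close>

text \<open>An active constraint is preserved by the sign of \<open>a i \<bullet> d\<close>, an
  inactive one by continuity for small \<open>t\<close>.\<close>

lemma eventually_feasible_direction:
  fixes y d :: "'a::euclidean_space"
  assumes "finite I" and "\<And>i. i \<in> I \<Longrightarrow> a i \<bullet> y \<le> c i"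
    and "\<And>i. i \<in> I \<Longrightarrow> a i \<bullet> y = c i \<Longrightarrow> a i \<bullet> d \<le> 0"
  shows "\<forall>\<^sub>F t::real in at_right 0. \<forall>i\<in>I. a i \<bullet> (y + t *\<^sub>R d) \<le> c i"
proof (rule eventually_ball_finite[OF assms(1)], rule ballI)
  fix i assume i: "i \<in> I"
  show "\<forall>\<^sub>F t::real in at_right 0. a i \<bullet> (y + t *\<^sub>R d) \<le> c i"
  proof (cases "a i \<bullet> y = c i")
    case True
    with assms(3)[OF i] show ?thesis
      by (intro eventually_at_rightI[of 0 1]) (auto simp: inner_add_right mult_nonneg_nonpos)
  next
    case False
    with assms(2)[OF i] have "a i \<bullet> y < c i" by simp
    moreover have "((\<lambda>t. a i \<bullet> (y + t *\<^sub>R d)) \<longlongrightarrow> a i \<bullet> (y + 0 *\<^sub>R d)) (at_right 0)"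
      by (intro tendsto_intros)
    ultimately have "\<forall>\<^sub>F t in at_right 0. a i \<bullet> (y + t *\<^sub>R d) < c i"
      by (intro order_tendstoD) auto
    then show ?thesis by eventually_elim simp
  qed
qed

text \<open>Along the ray the difference quotient is constantly
  \<open>zs \<bullet> d / norm d\<close>. A positive value would keep the upper limit at
  \<open>z\<close> above zero.\<close>

lemma regular_normal_wrt_direction:
  fixes z d :: "'a::euclidean_space"
  assumes zs: "zs \<in> regular_normal_wrt D z \<Omega>"
    and dir: "\<forall>\<^sub>F t::real in at_right 0. z + t *\<^sub>R d \<in> \<Omega> \<inter> D"
  shows "zs \<bullet> d \<le> 0"
proof (rule ccontr)
  assume "\<not> zs \<bullet> d \<le> 0"
  then have pos: "zs \<bullet> d > 0" and "d \<noteq> 0" by auto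
  define e where "e = zs \<bullet> d / norm d"
  have "e > 0" using pos \<open>d \<noteq> 0\<close> by (simp add: e_def)
  have "Limsup (at z within (\<Omega> \<inter> D)) (\<lambda>y. ereal (zs \<bullet> (y - z) / norm (y - z))) \<le> 0"
    using zs by (simp add: regular_normal_wrt_def)
  also have "\<dots> < ereal e" using \<open>e > 0\<close> by simp
  finally have lt: "\<forall>\<^sub>F y in at z within (\<Omega> \<inter> D). ereal (zs \<bullet> (y - z) / norm (y - z)) < ereal e"
    by (rule Limsup_lessD)
  have lim: "filterlim (\<lambda>t. z + t *\<^sub>R d) (at z within (\<Omega> \<inter> D)) (at_right (0::real))"
    unfolding filterlim_at
  proof
    show "\<forall>\<^sub>F t in at_right 0. z + t *\<^sub>R d \<in> \<Omega> \<inter> D \<and> z + t *\<^sub>R d \<noteq> z"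
      using dir eventually_at_right_less[of "0::real"]
      by eventually_elim (use \<open>d \<noteq> 0\<close> in auto)
    have "((\<lambda>t. z + t *\<^sub>R d) \<longlongrightarrow> z + 0 *\<^sub>R d) (at_right 0)"
      by (intro tendsto_intros)
    then show "((\<lambda>t. z + t *\<^sub>R d) \<longlongrightarrow> z) (at_right 0)" by simp
  qed
  have "\<forall>\<^sub>F t::real in at_right 0. zs \<bullet> (t *\<^sub>R d) / norm (t *\<^sub>R d) < e"
    using eventually_compose_filterlim[OF lt lim] by simp
  then have "\<forall>\<^sub>F t::real in at_right 0. False"
    using eventually_at_right_less[of "0::real"]
    by eventually_elim (simp add: e_def)
  then show False by simp
qed

text \<open>If the numerator is nonpositive near \<open>z\<close>, so is the quotient, and no error
  term has to be estimated. Polyhedral structure supplies this exact inequality.\<close>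

lemma regular_normal_wrtI:
  assumes "p > 0" "z + p *\<^sub>R zs \<in> D"
    and "\<forall>\<^sub>F y in nhds z. y \<in> \<Omega> \<inter> D \<longrightarrow> zs \<bullet> (y - z) \<le> 0"
  shows "zs \<in> regular_normal_wrt D z \<Omega>"
proof -
  have "\<forall>\<^sub>F y in at z within (\<Omega> \<inter> D). ereal (zs \<bullet> (y - z) / norm (y - z)) \<le> 0"
    unfolding eventually_at_filter using assms(3)
    by eventually_elim (auto simp: divide_nonpos_nonneg)
  then have "Limsup (at z within (\<Omega> \<inter> D)) (\<lambda>y. ereal (zs \<bullet> (y - z) / norm (y - z))) \<le> 0"
    by (rule Limsup_bounded)
  with assms(1,2) show ?thesis
    by (auto simp: regular_normal_wrt_def)
qed

section \<open>Active sets, the normal cone to a polyhedron and their local stability\<close>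

lemma finite_active [simp]:
  "finite (active1 a b l1 y)" "finite (active2 a l1 l y)" "finite (active a b l1 l y)"
  by (auto simp: active_def active1_def active2_def idx1_def idx2_def)

lemma finite_idx [simp]: "finite (idx1 l1)" "finite (idx2 l1 l)"
  by (auto simp: idx1_def idx2_def)

lemma active_Int_idx:
  "active a b l1 l y \<inter> idx1 l1 = active1 a b l1 y"
  "active a b l1 l y \<inter> idx2 l1 l = active2 a l1 l y"
  by (auto simp: active_def active1_def active2_def idx1_def idx2_def)

text \<open>A direction that is nonpositive on the active generators stays in the polyhedron for
  small steps, so every normal is nonpositive on it and Farkas' lemma applies. Conversely, each
  active generator is normal because its constraint is tight at \<open>y\<close>.\<close>

lemma convex_normal_cone_poly_Theta:
  assumes "y \<in> poly_Theta a b l1"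
  shows "convex_normal_cone y (poly_Theta a b l1) = convex_cone hull (a ` active1 a b l1 y)"
proof (intro equalityI subsetI)
  fix v assume v: "v \<in> convex_normal_cone y (poly_Theta a b l1)"
  show "v \<in> convex_cone hull (a ` active1 a b l1 y)"
  proof (rule farkas)
    fix d assume d: "\<And>s. s \<in> a ` active1 a b l1 y \<Longrightarrow> s \<bullet> d \<le> 0"
    have "\<forall>\<^sub>F t::real in at_right 0. \<forall>i\<in>idx1 l1. a i \<bullet> (y + t *\<^sub>R d) \<le> b i"
      using assms d by (intro eventually_feasible_direction) (auto simp: poly_Theta_def active1_def)
    then have "\<forall>\<^sub>F t::real in at_right 0. v \<bullet> d \<le> 0"
      using eventually_at_right_less[of "0::real"]
    proof eventually_elim
      case (elim t)
      then have "v \<bullet> (y + t *\<^sub>R d - y) \<le> 0"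
        using v unfolding convex_normal_cone_def poly_Theta_def by blast
      with elim show ?case by (simp add: mult_le_0_iff)
    qed
    then show "v \<bullet> d \<le> 0" by simp
  qed simp
next
  fix v assume v: "v \<in> convex_cone hull (a ` active1 a b l1 y)"
  have "v \<bullet> (z - y) \<le> 0" if "z \<in> poly_Theta a b l1" for z
    using v by (rule inner_convex_cone_hull_nonpos)
      (use that in \<open>auto simp: active1_def poly_Theta_def inner_diff_right\<close>)
  then show "v \<in> convex_normal_cone y (poly_Theta a b l1)"
    by (simp add: convex_normal_cone_def)
qed

lemma gph_normal_cone_map_iff:
  "(y, ys) \<in> gph (normal_cone_map (poly_Theta a b l1)) \<longleftrightarrow>
     y \<in> poly_Theta a b l1 \<and> ys \<in> convex_cone hull (a ` active1 a b l1 y)"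
  by (auto simp: gph_def normal_cone_map_def convex_normal_cone_poly_Theta)

text \<open>Differing from the bound is an open condition, so a constraint that is not tight at
  \<open>y\<close> is not tight at nearby points either; finitely many constraints share a
  neighbourhood.\<close>

lemma eventually_active_subset:
  fixes y :: "'a::euclidean_space"
  shows "\<forall>\<^sub>F y' in nhds y. active1 a b l1 y' \<subseteq> active1 a b l1 y \<and> active2 a l1 l y' \<subseteq> active2 a l1 l y"
proof -
  have stay: "\<forall>\<^sub>F y' in nhds y. a i \<bullet> y' = c \<longrightarrow> a i \<bullet> y = c" for i and c :: real
  proof (cases "a i \<bullet> y = c")
    case False
    have "((\<lambda>y'. a i \<bullet> y') \<longlongrightarrow> a i \<bullet> y) (nhds y)" by (intro tendsto_intros filterlim_ident)
    then have "\<forall>\<^sub>F y' in nhds y. a i \<bullet> y' \<noteq> c" using False by (rule tendsto_imp_eventually_ne)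
    then show ?thesis by eventually_elim simp
  qed simp
  have "\<forall>\<^sub>F y' in nhds y. \<forall>i\<in>idx1 l1. a i \<bullet> y' = b i \<longrightarrow> a i \<bullet> y = b i"
    "\<forall>\<^sub>F y' in nhds y. \<forall>i\<in>idx2 l1 l. a i \<bullet> y' = 0 \<longrightarrow> a i \<bullet> y = 0"
    by (auto intro!: eventually_ball_finite stay)
  then show ?thesis by eventually_elim (auto simp: active1_def active2_def)
qed

text \<open>Each of the finitely many cones is closed, so one that misses \<open>ys\<close> also
  misses a neighbourhood of it. This transfers normality from a nearby \<open>ys'\<close> back to
  \<open>ys\<close> at the same base point.\<close>

lemma eventually_in_convex_cone_hull_imp:
  fixes ys :: "'a::euclidean_space"
  assumes "finite I"
  shows "\<forall>\<^sub>F ys' in nhds ys. \<forall>R\<in>Pow I. ys' \<in> convex_cone hull (a ` R) \<longrightarrow> ys \<in> convex_cone hull (a ` R)"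
proof (rule eventually_ball_finite)
  show "\<forall>R\<in>Pow I. \<forall>\<^sub>F ys' in nhds ys. ys' \<in> convex_cone hull (a ` R) \<longrightarrow> ys \<in> convex_cone hull (a ` R)"
  proof
    fix R assume "R \<in> Pow I"
    then have "finite R" using assms finite_subset by auto
    then have "open (- (convex_cone hull (a ` R)))"
      by (intro open_Compl polyhedron_imp_closed polyhedron_convex_cone_hull) simp
    then show "\<forall>\<^sub>F ys' in nhds ys. ys' \<in> convex_cone hull (a ` R) \<longrightarrow> ys \<in> convex_cone hull (a ` R)"
      by (cases "ys \<in> convex_cone hull (a ` R)") (auto dest: eventually_nhds_in_open)
  qed
qed (use assms in simp)

section \<open>Regular normals to the graph of the normal cone mapping\<close>

text \<open>One inclusion tests a normal against horizontal directions \<open>(d, 0)\<close> and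
  vertical directions \<open>(0, s)\<close> that stay in the graph. For the other, nearby graph
  points satisfy \<open>y' - y \<in> B_set\<close> and
  \<open>ys' \<bullet> w \<le> 0 = ys \<bullet> w\<close>, so both parts of the inner product are
  nonpositive.\<close>

lemma regular_normal_gph_normal_cone:
  fixes a :: "nat \<Rightarrow> 'a::euclidean_space"
  assumes y: "y \<in> poly_Theta a b l1" "y \<in> poly_C a l1 l"
    and P: "P \<subseteq> active1 a b l1 y" and lam: "\<And>i. i \<in> P \<Longrightarrow> lam i > 0"
    and ys: "ys = (\<Sum>i\<in>P. lam i *\<^sub>R a i)"
  shows "regular_normal_wrt (poly_C a l1 l \<times> UNIV) (y, ys)
           (gph (normal_cone_map (poly_Theta a b l1)) \<inter> (poly_C a l1 l \<times> UNIV)) =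
         (A_set a (active a b l1 l y) P \<inter> T_set a (active2 a l1 l y)) \<times> B_set a (active1 a b l1 y) P"
    (is "regular_normal_wrt ?D _ ?\<Omega> = ?R")
proof (rule set_eqI, clarify)
  fix v w
  let ?N = "\<lambda>y. convex_cone hull (a ` active1 a b l1 y)"
  have mem: "(y', ys') \<in> ?\<Omega> \<inter> ?D \<longleftrightarrow> y' \<in> poly_Theta a b l1 \<and> ys' \<in> ?N y' \<and> y' \<in> poly_C a l1 l"
    for y' ys' by (auto simp: gph_normal_cone_map_iff)
  have [simp]: "finite P" using P finite_active(1) finite_subset by blast
  have PQ: "P \<subseteq> active a b l1 l y" using P by (auto simp: active_def)
  have ysN: "ys \<in> ?N y'" if "P \<subseteq> active1 a b l1 y'" for y'
    unfolding ys using that lam by (intro sum_in_convex_cone_hull_image) (auto simp: less_imp_le)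
  show "(v, w) \<in> regular_normal_wrt ?D (y, ys) ?\<Omega> \<longleftrightarrow> (v, w) \<in> ?R"
  proof
    assume reg: "(v, w) \<in> regular_normal_wrt ?D (y, ys) ?\<Omega>"
    \<comment> \<open>The clause on \<open>p\<close> in the definition produces this factor: where a
      constraint of the cone is active, its value at \<open>y + p *\<^sub>R v\<close> is
      \<open>p\<close> times \<open>a i \<bullet> v\<close>.\<close>
    have vT: "v \<in> T_set a (active2 a l1 l y)"
    proof -
      obtain p where "p > 0" "y + p *\<^sub>R v \<in> poly_C a l1 l"
        using reg by (auto simp: regular_normal_wrt_def)
      then show ?thesis
        by (force simp: T_set_def active2_def poly_C_def inner_add_right mult_le_0_iff)
    qed
    \<comment> \<open>Moving \<open>y\<close> along \<open>d\<close> keeps the constraints in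
      \<open>P\<close> active, so the unchanged \<open>ys\<close> remains normal and the horizontal
      direction stays in the graph.\<close>
    have "v \<bullet> d \<le> 0" if d: "d \<in> B_set a (active a b l1 l y) P" for d
    proof -
      have "\<forall>\<^sub>F t::real in at_right 0. \<forall>i\<in>idx1 l1. a i \<bullet> (y + t *\<^sub>R d) \<le> b i"
        using y d by (intro eventually_feasible_direction)
          (auto simp: poly_Theta_def B_set_def T_set_def active_def active1_def)
      moreover have "\<forall>\<^sub>F t::real in at_right 0. \<forall>i\<in>idx2 l1 l. a i \<bullet> (y + t *\<^sub>R d) \<le> 0"
        using y d by (intro eventually_feasible_direction)
          (auto simp: poly_C_def B_set_def T_set_def active_def active2_def)
      ultimately have "\<forall>\<^sub>F t::real in at_right 0. (y, ys) + t *\<^sub>R (d, 0) \<in> ?\<Omega> \<inter> ?D"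
      proof eventually_elim
        case (elim t)
        have "P \<subseteq> active1 a b l1 (y + t *\<^sub>R d)"
          using P d by (auto simp: active1_def B_set_def inner_add_right)
        then have "(y + t *\<^sub>R d, ys) \<in> ?\<Omega> \<inter> ?D"
          unfolding mem using elim ysN by (simp add: poly_Theta_def poly_C_def)
        then show ?case by simp
      qed
      from regular_normal_wrt_direction[OF reg this] show ?thesis by simp
    qed
    then have vA: "v \<in> A_set a (active a b l1 l y) P"
      by (simp add: A_set_iff_polar PQ)
    have wN: "s \<bullet> w \<le> 0" if "\<forall>\<^sub>F t::real in at_right 0. ys + t *\<^sub>R s \<in> ?N y" for s
    proof -
      have "\<forall>\<^sub>F t::real in at_right 0. (y, ys) + t *\<^sub>R (0, s) \<in> ?\<Omega> \<inter> ?D"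
        using that by eventually_elim (use y in \<open>simp add: gph_normal_cone_map_iff\<close>)
      from regular_normal_wrt_direction[OF reg this] show ?thesis by (simp add: inner_commute)
    qed
    have le: "a i \<bullet> w \<le> 0" if "i \<in> active1 a b l1 y" for i
    proof (rule wN)
      have "ys + t *\<^sub>R a i \<in> ?N y" if "t > 0" for t
        using \<open>i \<in> _\<close> that by (intro convex_cone_hull_add ysN P convex_cone_hull_mul hull_inc) auto
      then show "\<forall>\<^sub>F t::real in at_right 0. ys + t *\<^sub>R a i \<in> ?N y"
        by (intro eventually_at_rightI[of 0 1]) auto
    qed
    \<comment> \<open>Since \<open>lam i\<close> is strictly positive, a small multiple of
      \<open>a i\<close> can also be subtracted from \<open>ys\<close> without leaving the cone;
      this yields equality on \<open>P\<close>.\<close>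
    have ge: "(- a i) \<bullet> w \<le> 0" if "i \<in> P" for i
    proof (rule wN)
      have "ys + t *\<^sub>R (- a i) \<in> ?N y" if "t < lam i" for t
      proof -
        define c where "c = lam(i := lam i - t)"
        have "(\<Sum>j\<in>P. c j *\<^sub>R a j) = ys + t *\<^sub>R (- a i)"
          using \<open>i \<in> P\<close> by (simp add: ys c_def sum.remove[of P i] algebra_simps)
        moreover have "\<forall>j\<in>P. c j \<ge> 0"
          using lam that by (auto simp: c_def less_imp_le)
        ultimately show ?thesis
          using sum_in_convex_cone_hull_image[OF \<open>finite P\<close> P, of c a] by simp
      qed
      then show "\<forall>\<^sub>F t::real in at_right 0. ys + t *\<^sub>R (- a i) \<in> ?N y"
        using lam[OF that] by (intro eventually_at_rightI[of 0 "lam i"]) auto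
    qed
    have "w \<in> B_set a (active1 a b l1 y) P"
      using le ge P by (force simp: B_set_def T_set_def)
    with vT vA show "(v, w) \<in> ?R" by simp
  next
    assume "(v, w) \<in> ?R"
    then have vA: "v \<in> A_set a (active a b l1 l y) P" and vT: "v \<in> T_set a (active2 a l1 l y)"
      and w: "w \<in> B_set a (active1 a b l1 y) P" by auto
    \<comment> \<open>Membership of \<open>v\<close> in \<open>T_set\<close> makes it a feasible
      direction, so any sufficiently small step length can serve as \<open>p\<close>.\<close>
    have "\<forall>\<^sub>F t::real in at_right 0. \<forall>i\<in>idx2 l1 l. a i \<bullet> (y + t *\<^sub>R v) \<le> 0"
      using y vT by (intro eventually_feasible_direction) (auto simp: poly_C_def T_set_def active2_def)
    then have "\<forall>\<^sub>F t::real in at_right 0. t > 0 \<and> y + t *\<^sub>R v \<in> poly_C a l1 l"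
      using eventually_at_right_less[of "0::real"] by eventually_elim (simp add: poly_C_def)
    then obtain p :: real where p: "p > 0" "y + p *\<^sub>R v \<in> poly_C a l1 l"
      using eventually_happens'[OF trivial_limit_at_right_real] by blast
    have "\<forall>\<^sub>F z in nhds y \<times>\<^sub>F nhds ys. z \<in> ?\<Omega> \<inter> ?D \<longrightarrow> (v, w) \<bullet> (z - (y, ys)) \<le> 0"
      using eventually_prodI[OF eventually_active_subset[of a b l1 y l]
          eventually_in_convex_cone_hull_imp[OF finite_idx(1)[of l1], of a ys]]
    proof eventually_elim
      case (elim z)
      obtain y' ys' where z: "z = (y', ys')" by (cases z)
      show ?case
      proof
        assume "z \<in> ?\<Omega> \<inter> ?D"
        then have y': "y' \<in> poly_Theta a b l1" "ys' \<in> ?N y'" "y' \<in> poly_C a l1 l"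
          unfolding z mem by auto
        have act: "active1 a b l1 y' \<subseteq> active1 a b l1 y" "active2 a l1 l y' \<subseteq> active2 a l1 l y"
          using elim by (auto simp: z)
        have "active1 a b l1 y' \<in> Pow (idx1 l1)" by (auto simp: active1_def)
        \<comment> \<open>\<open>ys\<close> is normal at \<open>y'\<close>, so \<open>ys \<bullet> (y - y') \<le> 0\<close>, yet each term of this inner product is
          nonnegative.\<close>
        with elim y'(2) have "ys \<in> ?N y'" by (auto simp: z)
        then have "ys \<bullet> (y - y') \<le> 0"
          by (rule inner_convex_cone_hull_nonpos)
            (use y(1) in \<open>auto simp: active1_def poly_Theta_def inner_diff_right\<close>)
        then have "(\<Sum>i\<in>P. lam i * (a i \<bullet> (y - y'))) \<le> 0"
          by (simp add: ys inner_sum_left)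
        moreover have nonneg: "lam i * (a i \<bullet> (y - y')) \<ge> 0" if "i \<in> P" for i
          using lam[OF that] P that y'(1)
          by (intro mult_nonneg_nonneg) (auto simp: active1_def poly_Theta_def inner_diff_right)
        ultimately have "(\<Sum>i\<in>P. lam i * (a i \<bullet> (y - y'))) = 0"
          by (intro antisym sum_nonneg) auto
        then have "lam i * (a i \<bullet> (y - y')) = 0" if "i \<in> P" for i
          using nonneg that by (simp add: sum_nonneg_eq_0_iff)
        then have "a i \<bullet> (y' - y) = 0" if "i \<in> P" for i
          using lam[OF that] that by (force simp: inner_diff_right)
        \<comment> \<open>Constraints in \<open>P\<close> are tight at both points; the other
          constraints active at \<open>y\<close> are tight there and hold as inequalities at
          \<open>y'\<close>.\<close>
        then have "y' - y \<in> B_set a (active a b l1 l y) P"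
          using y' by (auto simp: B_set_def T_set_def active_def active1_def active2_def
              poly_Theta_def poly_C_def inner_diff_right)
        then have "v \<bullet> (y' - y) \<le> 0"
          using vA by (simp add: A_set_iff_polar PQ)
        \<comment> \<open>The generators of \<open>ys'\<close> are active at \<open>y\<close> too,
          where \<open>w\<close> is nonpositive on them, whereas \<open>ys\<close> uses only
          generators in \<open>P\<close>, which \<open>w\<close> annihilates.\<close>
        moreover have "ys' \<bullet> w \<le> 0"
          using y'(2) by (rule inner_convex_cone_hull_nonpos)
            (use w act in \<open>auto simp: B_set_def T_set_def\<close>)
        moreover have "ys \<bullet> w = 0"
          using w by (simp add: ys inner_sum_left B_set_def)
        ultimately show "(v, w) \<bullet> (z - (y, ys)) \<le> 0"
          by (simp add: z inner_diff_right inner_commute)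
      qed
    qed
    then show "(v, w) \<in> regular_normal_wrt ?D (y, ys) ?\<Omega>"
      using p by (intro regular_normal_wrtI[of p]) (simp_all add: nhds_prod)
  qed
qed

section \<open>Closedness and passage to limiting normals\<close>

lemma closed_T_set: "closed (T_set a Q)"
proof -
  have "T_set a Q = (\<Inter>i\<in>Q. {u. a i \<bullet> u \<le> 0})" by (auto simp: T_set_def)
  then show ?thesis by (simp add: closed_INT closed_halfspace_le)
qed

lemma closed_B_set: "closed (B_set a Q P)"
proof -
  have "B_set a Q P = T_set a Q \<inter> (\<Inter>i\<in>P. {u. a i \<bullet> u = 0})" by (auto simp: B_set_def)
  then show ?thesis by (auto intro!: closed_Int closed_INT closed_T_set closed_hyperplane)
qed

text \<open>As a polar, the set is an intersection of closed halfspaces.\<close>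

lemma closed_A_set:
  assumes "finite Q" and "P \<subseteq> Q"
  shows "closed (A_set a Q P)"
proof -
  have "A_set a Q P = (\<Inter>d\<in>B_set a Q P. {v. d \<bullet> v \<le> 0})"
    by (auto simp: A_set_iff_polar[OF assms] inner_commute)
  then show ?thesis by (simp add: closed_INT closed_halfspace_le)
qed

text \<open>Regular normals are determined by pairs \<open>(Q, P)\<close>, so it remains to find the
  pairs occurring arbitrarily close to \<open>(x, xs)\<close>: nonemptiness of \<open>C_set\<close>
  selects \<open>Q\<close>, and membership in \<open>P_sets\<close> selects
  \<open>P\<close>.\<close>

lemma limiting_coderivative_normal_cone_map:
  fixes a :: "nat \<Rightarrow> 'a::euclidean_space"
  assumes xC: "x \<in> poly_C a l1 l"
    and gph: "(x, xs) \<in> gph (normal_cone_map (poly_Theta a b l1))"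
  shows "v \<in> limiting_coderivative_wrt (poly_C a l1 l) (normal_cone_map (poly_Theta a b l1)) x xs u \<longleftrightarrow>
    (\<exists>Q P. Q \<subseteq> active a b l1 l x \<and> P \<in> P_sets a b l1 x xs \<and>
       C_set a (active a b l1 l x) Q \<noteq> {} \<and> P \<subseteq> Q \<inter> idx1 l1 \<and>
       (v, - u) \<in> (A_set a Q P \<inter> T_set a (Q \<inter> idx2 l1 l)) \<times> B_set a (Q \<inter> idx1 l1) P)"
    (is "?L \<longleftrightarrow> ?R")
proof
  let ?G = "gph (normal_cone_map (poly_Theta a b l1)) \<inter> (poly_C a l1 l \<times> UNIV)"
  let ?D = "poly_C a l1 l \<times> UNIV"
  let ?I = "active a b l1 l"
  have x: "x \<in> poly_Theta a b l1"
    using gph by (simp add: gph_normal_cone_map_iff)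
  {
    assume ?L
    then obtain z zs where z: "z \<longlonglongrightarrow> (x, xs)" and zs: "zs \<longlonglongrightarrow> (v, - u)"
      and mem: "\<And>k. z k \<in> ?G \<inter> ?D" and reg: "\<And>k. zs k \<in> regular_normal_wrt ?D (z k) ?G"
      by (auto simp: limiting_coderivative_wrt_def limiting_normal_wrt_def)
    define y where "y k = fst (z k)" for k
    have y_snd: "(y k, snd (z k)) = z k" for k by (simp add: y_def)
    have "(y k, snd (z k)) \<in> ?G \<inter> ?D" for k
      unfolding y_snd by (rule mem)
    then have yTC: "y k \<in> poly_Theta a b l1" "y k \<in> poly_C a l1 l"
      and N: "snd (z k) \<in> convex_cone hull (a ` active1 a b l1 (y k))" for k
      by (simp_all add: gph_normal_cone_map_iff)
    have "\<exists>P lam. P \<subseteq> active1 a b l1 (y k) \<and> (\<forall>i\<in>P. lam i > 0) \<and> snd (z k) = (\<Sum>i\<in>P. lam i *\<^sub>R a i)" for k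
      using N[of k] by (rule convex_cone_hull_positive_combination[rotated]) auto
    then obtain P lam where P: "\<And>k. P k \<subseteq> active1 a b l1 (y k)" "\<And>k i. i \<in> P k \<Longrightarrow> lam k i > 0"
      "\<And>k. snd (z k) = (\<Sum>i\<in>P k. lam k i *\<^sub>R a i)"
      by metis
    have range: "(?I (y k), P k) \<in> Pow (idx1 l1 \<union> idx2 l1 l) \<times> Pow (idx1 l1)" for k
      using P(1)[of k] by (auto simp: active_def active1_def active2_def)
    have "finite (range (\<lambda>k. (?I (y k), P k)))"
      by (intro finite_subset[OF image_subsetI[OF range]]) simp
    then obtain k0 where "infinite {k \<in> UNIV. (?I (y k), P k) = (?I (y k0), P k0)}"
      using pigeonhole_infinite[of "UNIV :: nat set"] by blast
    then obtain r :: "nat \<Rightarrow> nat" where r: "strict_mono r" and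
      "\<And>k. r k \<in> {k \<in> UNIV. (?I (y k), P k) = (?I (y k0), P k0)}"
      using infinite_enumerate by blast
    then obtain Q P' where QP: "\<And>k. ?I (y (r k)) = Q" "\<And>k. P (r k) = P'"
      by force
    have Q1: "active1 a b l1 (y (r k)) = Q \<inter> idx1 l1" and Q2: "active2 a l1 l (y (r k)) = Q \<inter> idx2 l1 l" for k
      unfolding QP(1)[of k, symmetric] active_Int_idx by simp_all
    have P'Q: "P' \<subseteq> Q \<inter> idx1 l1"
      using P(1)[of "r 0"] by (simp add: QP Q1)
    have [simp]: "finite Q" using QP(1)[of 0] finite_active(3) by metis
    have [simp]: "finite P'" by (rule finite_subset[OF P'Q]) simp
    have "(\<lambda>k. z (r k)) \<longlonglongrightarrow> (x, xs)" and zsr: "(\<lambda>k. zs (r k)) \<longlonglongrightarrow> (v, - u)"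
      using LIMSEQ_subseq_LIMSEQ[OF z r] LIMSEQ_subseq_LIMSEQ[OF zs r] by (simp_all add: o_def)
    then have yr: "(\<lambda>k. y (r k)) \<longlonglongrightarrow> x" and sr: "(\<lambda>k. snd (z (r k))) \<longlonglongrightarrow> xs"
      unfolding y_def by (auto dest: tendsto_fst tendsto_snd)
    have "\<forall>\<^sub>F k in sequentially. ?I (y (r k)) \<subseteq> ?I x"
      using eventually_compose_filterlim[OF eventually_active_subset[of a b l1 x l] yr]
      by eventually_elim (auto simp: active_def)
    then have QI: "Q \<subseteq> ?I x" by (simp add: QP)
    \<comment> \<open>One term of the subsequence already gives an element of \<open>C_set\<close>:
      among the constraints active at \<open>x\<close>, those tight at \<open>y (r 0)\<close> are
      exactly the ones in \<open>Q\<close>.\<close>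
    have "a i \<bullet> (y (r 0) - x) = 0" if "i \<in> Q" for i
    proof -
      have "i \<in> ?I x" "i \<in> ?I (y (r 0))" using that QI QP(1)[of 0] by auto
      then show ?thesis
        by (auto simp: active_def active1_def active2_def idx1_def idx2_def inner_diff_right)
    qed
    moreover have "a i \<bullet> (y (r 0) - x) < 0" if "i \<in> ?I x - Q" for i
    proof -
      have "i \<in> ?I x" "i \<notin> ?I (y (r 0))" using that QP(1)[of 0] by auto
      then show ?thesis
        using yTC[of "r 0"]
        by (auto simp: active_def active1_def active2_def poly_Theta_def poly_C_def inner_diff_right
            order.order_iff_strict)
    qed
    ultimately have CQ: "C_set a (?I x) Q \<noteq> {}" unfolding C_set_def by blast
    \<comment> \<open>Nothing bounds the coefficients \<open>lam (r k)\<close>, so the limit is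
      taken in the closed cone generated by \<open>P'\<close> rather than in the
      coefficients.\<close>
    have "snd (z (r k)) \<in> convex_cone hull (a ` P')" for k
      unfolding P(3) QP
      by (rule sum_in_convex_cone_hull_image) (use P(2)[of _ "r k"] in \<open>auto simp: QP less_imp_le\<close>)
    moreover have "closed (convex_cone hull (a ` P'))"
      by (intro polyhedron_imp_closed polyhedron_convex_cone_hull) simp
    ultimately have "xs \<in> convex_cone hull (a ` P')"
      using sr closed_sequentially[of _ "\<lambda>k. snd (z (r k))" xs] by simp
    then have PP: "P' \<in> P_sets a b l1 x xs"
      using P'Q QI active_Int_idx(1)[of a b l1 l x] by (auto simp: P_sets_def)
    have zsr_in: "zs (r k) \<in> (A_set a Q P' \<inter> T_set a (Q \<inter> idx2 l1 l)) \<times> B_set a (Q \<inter> idx1 l1) P'" for k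
      using reg[of "r k"] regular_normal_gph_normal_cone[OF yTC P, of "r k"]
      unfolding y_snd QP Q1 Q2 by simp
    have "closed ((A_set a Q P' \<inter> T_set a (Q \<inter> idx2 l1 l)) \<times> B_set a (Q \<inter> idx1 l1) P')"
      using P'Q by (intro closed_Times closed_Int closed_A_set closed_T_set closed_B_set) auto
    then have "(v, - u) \<in> (A_set a Q P' \<inter> T_set a (Q \<inter> idx2 l1 l)) \<times> B_set a (Q \<inter> idx1 l1) P'"
      using zsr_in zsr by (rule closed_sequentially)
    then show ?R using QI PP CQ P'Q by blast
  }
  {
    assume ?R
    then obtain Q P where QI: "Q \<subseteq> ?I x" and P: "P \<in> P_sets a b l1 x xs" "P \<subseteq> Q \<inter> idx1 l1"
      and CQ: "C_set a (?I x) Q \<noteq> {}"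
      and vu: "(v, - u) \<in> (A_set a Q P \<inter> T_set a (Q \<inter> idx2 l1 l)) \<times> B_set a (Q \<inter> idx1 l1) P"
      by blast
    have [simp]: "finite P" by (rule finite_subset[OF P(2)]) simp
    obtain d where d: "\<And>i. i \<in> Q \<Longrightarrow> a i \<bullet> d = 0" "\<And>i. i \<in> ?I x - Q \<Longrightarrow> a i \<bullet> d < 0"
      using CQ by (auto simp: C_set_def)
    have d_le: "a i \<bullet> d \<le> 0" if "i \<in> ?I x" for i
      using d that by (cases "i \<in> Q") (auto simp: less_imp_le)
    obtain c where c: "\<forall>i\<in>P. c i \<ge> 0" "xs = (\<Sum>i\<in>P. c i *\<^sub>R a i)"
      using P(1) by (auto simp: P_sets_def convex_cone_hull_image_finite)
    define y where "y t = x + t *\<^sub>R d" for t :: real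
    \<comment> \<open>Adding \<open>t\<close> to every coefficient makes all of them positive,
      including those with \<open>c i = 0\<close>, so \<open>P\<close> itself serves as the index
      set of a strictly positive representation.\<close>
    define ys where "ys t = (\<Sum>i\<in>P. (c i + t) *\<^sub>R a i)" for t :: real
    have y_lim: "(y \<longlongrightarrow> x) (at_right 0)"
    proof -
      have "(y \<longlongrightarrow> x + 0 *\<^sub>R d) (at_right 0)" unfolding y_def by (intro tendsto_intros)
      then show ?thesis by simp
    qed
    have ys_lim: "(ys \<longlongrightarrow> xs) (at_right 0)"
    proof -
      have "(ys \<longlongrightarrow> (\<Sum>i\<in>P. (c i + 0) *\<^sub>R a i)) (at_right 0)" unfolding ys_def by (intro tendsto_intros)
      then show ?thesis by (simp add: c(2))
    qed
    have "\<forall>\<^sub>F t::real in at_right 0. \<forall>i\<in>idx1 l1. a i \<bullet> (x + t *\<^sub>R d) \<le> b i"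
      using x d_le by (intro eventually_feasible_direction)
        (auto simp: poly_Theta_def active_def active1_def)
    moreover have "\<forall>\<^sub>F t::real in at_right 0. \<forall>i\<in>idx2 l1 l. a i \<bullet> (x + t *\<^sub>R d) \<le> 0"
      using xC d_le by (intro eventually_feasible_direction)
        (auto simp: poly_C_def active_def active2_def)
    moreover have "\<forall>\<^sub>F t in at_right 0. active1 a b l1 (y t) \<subseteq> active1 a b l1 x \<and> active2 a l1 l (y t) \<subseteq> active2 a l1 l x"
      using eventually_compose_filterlim[OF eventually_active_subset y_lim] .
    ultimately have "\<forall>\<^sub>F t in at_right 0. (y t, ys t) \<in> ?G \<inter> ?D \<and> (v, - u) \<in> regular_normal_wrt ?D (y t, ys t) ?G"
      using eventually_at_right_less[of "0::real"]
    proof eventually_elim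
      case (elim t)
      have yTC: "y t \<in> poly_Theta a b l1" "y t \<in> poly_C a l1 l"
        using elim by (auto simp: y_def poly_Theta_def poly_C_def)
      \<comment> \<open>For small \<open>t\<close> no constraint outside those active at
        \<open>x\<close> becomes active; among the latter, \<open>d\<close> keeps those in
        \<open>Q\<close> tight and makes the rest slack. Hence the active set of \<open>y t\<close>
        is exactly \<open>Q\<close>.\<close>
      have "i \<in> Q" if "i \<in> ?I (y t)" for i
      proof (rule ccontr)
        assume "i \<notin> Q"
        moreover have "i \<in> ?I x" using that elim by (auto simp: active_def)
        ultimately have "t * (a i \<bullet> d) < 0" using d(2) elim by (simp add: mult_pos_neg)
        moreover have "t * (a i \<bullet> d) = 0"
          using that \<open>i \<in> ?I x\<close>
          by (auto simp: active_def active1_def active2_def idx1_def idx2_def y_def inner_add_right)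
        ultimately show False by simp
      qed
      moreover have "i \<in> ?I (y t)" if "i \<in> Q" for i
        using subsetD[OF QI that] d(1)[OF that]
        by (auto simp: active_def active1_def active2_def y_def inner_add_right)
      ultimately have Q: "?I (y t) = Q" by blast
      have Q1: "active1 a b l1 (y t) = Q \<inter> idx1 l1" and Q2: "active2 a l1 l (y t) = Q \<inter> idx2 l1 l"
        unfolding Q[symmetric] active_Int_idx by simp_all
      have pos: "c i + t > 0" if "i \<in> P" for i
        using c(1) that elim by (simp add: add_nonneg_pos)
      have "P \<subseteq> active1 a b l1 (y t)" using P(2) Q1 by simp
      from regular_normal_gph_normal_cone[OF yTC this pos ys_def]
      have "(v, - u) \<in> regular_normal_wrt ?D (y t, ys t) ?G"
        using vu by (simp add: Q Q1 Q2)
      moreover have "ys t \<in> convex_cone hull (a ` active1 a b l1 (y t))"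
        unfolding ys_def using \<open>P \<subseteq> active1 a b l1 (y t)\<close> pos
        by (intro sum_in_convex_cone_hull_image) (auto simp: less_imp_le)
      ultimately show ?case
        using yTC by (simp add: gph_normal_cone_map_iff)
    qed
    moreover have inv: "filterlim (\<lambda>k. inverse (real (Suc k))) (at_right 0) sequentially"
      unfolding filterlim_at using LIMSEQ_inverse_real_of_nat by (auto intro: always_eventually)
    ultimately have "\<forall>\<^sub>F k in sequentially.
        (y (inverse (real (Suc k))), ys (inverse (real (Suc k)))) \<in> ?G \<inter> ?D \<and>
        (v, - u) \<in> regular_normal_wrt ?D (y (inverse (real (Suc k))), ys (inverse (real (Suc k)))) ?G"
      by (rule eventually_compose_filterlim)
    then obtain N where N: "\<And>k. k \<ge> N \<Longrightarrow>
        (y (inverse (real (Suc k))), ys (inverse (real (Suc k)))) \<in> ?G \<inter> ?D \<and>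
        (v, - u) \<in> regular_normal_wrt ?D (y (inverse (real (Suc k))), ys (inverse (real (Suc k)))) ?G"
      unfolding eventually_sequentially by blast
    have "(\<lambda>k. (y (inverse (real (Suc k))), ys (inverse (real (Suc k))))) \<longlonglongrightarrow> (x, xs)"
      by (intro tendsto_Pair filterlim_compose[OF y_lim inv] filterlim_compose[OF ys_lim inv])
    \<comment> \<open>A limiting normal requires membership for every index, so the sequence is
      shifted by \<open>N\<close>; the normals themselves form a constant sequence.\<close>
    from LIMSEQ_ignore_initial_segment[OF this, of N] N[OF le_add2] show ?L
      unfolding limiting_coderivative_wrt_def limiting_normal_wrt_def
      by (intro CollectI exI[of _ "\<lambda>k. (y (inverse (real (Suc (k + N)))), ys (inverse (real (Suc (k + N)))))"]
          exI[of _ "\<lambda>_. (v, - u)"] conjI allI) (simp_all del: of_nat_Suc)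
  }
qed

section \<open>Linearly independent generators\<close>

text \<open>A linear functional can be prescribed freely on an independent set, and its adjoint
  represents it as an inner product. Injectivity of the family ensures that no vector is assigned
  both values.\<close>

lemma independent_family_dual_vector:
  fixes a :: "nat \<Rightarrow> 'a::euclidean_space"
  assumes "independent_family a J" and "Q \<subseteq> J"
  obtains w where "\<And>i. i \<in> Q \<Longrightarrow> a i \<bullet> w = 0" "\<And>i. i \<in> J - Q \<Longrightarrow> a i \<bullet> w = - 1"
proof -
  have inj: "inj_on a J" and ind: "independent (a ` J)"
    using assms(1) by (auto simp: independent_family_def)
  obtain f :: "'a \<Rightarrow> real" where f: "linear f" "\<And>s. s \<in> a ` J \<Longrightarrow> f s = (if s \<in> a ` Q then 0 else - 1)"
    using linear_independent_extend[OF ind, of "\<lambda>s. if s \<in> a ` Q then 0 else - 1"] by blast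
  have repr: "s \<bullet> adjoint f 1 = f s" for s
    using adjoint_works[OF f(1), of s 1] by simp
  show thesis
  proof (rule that[of "adjoint f 1"])
    fix i assume "i \<in> Q"
    then show "a i \<bullet> adjoint f 1 = 0" using f(2)[of "a i"] assms(2) by (auto simp: repr)
  next
    fix i assume i: "i \<in> J - Q"
    then have "a i \<notin> a ` Q" using inj assms(2) by (auto simp: inj_on_def)
    then show "a i \<bullet> adjoint f 1 = - 1" using f(2)[of "a i"] i by (auto simp: repr)
  qed
qed

text \<open>Independence makes the coefficients of \<open>xs\<close> unique, so any admissible
  \<open>P\<close> must contain the indices with positive \<open>lam\<close>. Conversely, the terms
  with zero coefficient drop out of the given representation.\<close>

lemma P_sets_iff_positive_idx_subset:
  fixes a :: "nat \<Rightarrow> 'a::euclidean_space"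
  assumes ind: "independent_family a (active a b l1 l x)"
    and rep: "normal_representation a b l1 x xs J lam"
    and P: "P \<subseteq> active1 a b l1 x"
  shows "P \<in> P_sets a b l1 x xs \<longleftrightarrow> positive_idx J lam \<subseteq> P"
proof
  have J: "J \<subseteq> active1 a b l1 x" and lam: "\<forall>i\<in>J. lam i \<ge> 0" and xs: "xs = (\<Sum>i\<in>J. lam i *\<^sub>R a i)"
    using rep by (auto simp: normal_representation_def)
  have [simp]: "finite J" "finite P" using J P finite_active(1) finite_subset by blast+
  {
    assume "P \<in> P_sets a b l1 x xs"
    then obtain c where c: "xs = (\<Sum>i\<in>P. c i *\<^sub>R a i)"
      by (auto simp: P_sets_def convex_cone_hull_image_finite)
    show "positive_idx J lam \<subseteq> P"
    proof (rule subsetI, rule ccontr)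
      fix i assume i: "i \<in> positive_idx J lam" "i \<notin> P"
      \<comment> \<open>Pairing with \<open>w\<close> reads off minus the coefficient of
        \<open>a i\<close>: the representation over \<open>P\<close> gives zero, the one over
        \<open>J\<close> gives \<open>- lam i\<close>.\<close>
      obtain w where w: "\<And>j. j \<in> active a b l1 l x - {i} \<Longrightarrow> a j \<bullet> w = 0"
        and "\<And>j. j \<in> active a b l1 l x - (active a b l1 l x - {i}) \<Longrightarrow> a j \<bullet> w = - 1"
        using independent_family_dual_vector[OF ind Diff_subset[of _ "{i}"]] by blast
      then have wi: "a i \<bullet> w = - 1"
        using i J by (auto simp: positive_idx_def active_def)
      have "xs \<bullet> w = (\<Sum>j\<in>P. c j * (a j \<bullet> w))" by (simp add: c inner_sum_left)
      also have "\<dots> = 0"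
        using w P i(2) by (intro sum.neutral) (auto simp: active_def)
      finally have "xs \<bullet> w = 0" .
      moreover have "xs \<bullet> w = (\<Sum>j\<in>J. lam j * (a j \<bullet> w))" by (simp add: xs inner_sum_left)
      moreover have "\<dots> = (\<Sum>j\<in>{i}. lam j * (a j \<bullet> w))"
        using w J i(1) by (intro sum.mono_neutral_right) (auto simp: active_def positive_idx_def)
      ultimately show False using i(1) wi by (simp add: positive_idx_def)
    qed
  }
  {
    assume sub: "positive_idx J lam \<subseteq> P"
    have "xs = (\<Sum>i\<in>positive_idx J lam. lam i *\<^sub>R a i)"
      unfolding xs using lam
      by (intro sum.mono_neutral_right) (auto simp: positive_idx_def order.order_iff_strict)
    moreover have "finite (positive_idx J lam)" by (simp add: positive_idx_def)
    ultimately have "xs \<in> convex_cone hull (a ` P)"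
      using sum_in_convex_cone_hull_image[of "positive_idx J lam" P lam a] sub
      by (auto simp: positive_idx_def)
    then show "P \<in> P_sets a b l1 x xs"
      using P by (simp add: P_sets_def)
  }
qed

theorem theorem4p1:
  fixes a :: "nat \<Rightarrow> real ^ 'n" and b :: "nat \<Rightarrow> real" and l1 l :: nat
    and x xs :: "real ^ 'n"
  assumes "l1 \<le> l"
    and "x \<in> poly_C a l1 l"
    and "(x, xs) \<in> gph (normal_cone_map (poly_Theta a b l1))"
  shows "(\<forall>u. limiting_coderivative_wrt (poly_C a l1 l) (normal_cone_map (poly_Theta a b l1)) x xs u =
            {v. \<exists>Q P. Q \<subseteq> active a b l1 l x \<and> P \<in> P_sets a b l1 x xs \<and>
                      C_set a (active a b l1 l x) Q \<noteq> {} \<and> P \<subseteq> Q \<inter> idx1 l1 \<and>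
                      (v, - u) \<in> (A_set a Q P \<inter> T_set a (Q \<inter> idx2 l1 l)) \<times> B_set a (Q \<inter> idx1 l1) P})
       \<and> (independent_family a (active a b l1 l x) \<longrightarrow>
           (\<forall>J lam. normal_representation a b l1 x xs J lam \<longrightarrow>
             (\<forall>u. limiting_coderivative_wrt (poly_C a l1 l) (normal_cone_map (poly_Theta a b l1)) x xs u =
               {v. \<exists>Q P. Q \<subseteq> active a b l1 l x \<and>
                         positive_idx J lam \<subseteq> P \<and> P \<subseteq> Q \<inter> idx1 l1 \<and>
                         (v, - u) \<in> (A_set a Q P \<inter> T_set a (Q \<inter> idx2 l1 l)) \<times> B_set a (Q \<inter> idx1 l1) P})))"
proof (intro conjI allI impI)
  fix u
  show "limiting_coderivative_wrt (poly_C a l1 l) (normal_cone_map (poly_Theta a b l1)) x xs u =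
    {v. \<exists>Q P. Q \<subseteq> active a b l1 l x \<and> P \<in> P_sets a b l1 x xs \<and>
      C_set a (active a b l1 l x) Q \<noteq> {} \<and> P \<subseteq> Q \<inter> idx1 l1 \<and>
      (v, - u) \<in> (A_set a Q P \<inter> T_set a (Q \<inter> idx2 l1 l)) \<times> B_set a (Q \<inter> idx1 l1) P}"
    by (rule set_eqI) (simp only: limiting_coderivative_normal_cone_map[OF assms(2,3)] mem_Collect_eq)
next
  fix J lam u
  assume ind: "independent_family a (active a b l1 l x)"
    and rep: "normal_representation a b l1 x xs J lam"
  \<comment> \<open>The dual vector for \<open>Q\<close> is itself an element of
    \<open>C_set\<close>, so independence realises every subset of the active indices.\<close>
  have C: "C_set a (active a b l1 l x) Q \<noteq> {}" if "Q \<subseteq> active a b l1 l x" for Q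
  proof -
    obtain w where "\<And>i. i \<in> Q \<Longrightarrow> a i \<bullet> w = 0" "\<And>i. i \<in> active a b l1 l x - Q \<Longrightarrow> a i \<bullet> w = - 1"
      using independent_family_dual_vector[OF ind \<open>Q \<subseteq> _\<close>] by metis
    then have "w \<in> C_set a (active a b l1 l x) Q" by (simp add: C_set_def)
    then show ?thesis by blast
  qed
  have P: "P \<in> P_sets a b l1 x xs \<longleftrightarrow> positive_idx J lam \<subseteq> P"
    if "Q \<subseteq> active a b l1 l x" "P \<subseteq> Q \<inter> idx1 l1" for Q P
  proof (rule P_sets_iff_positive_idx_subset[OF ind rep])
    show "P \<subseteq> active1 a b l1 x"
      using that active_Int_idx(1)[of a b l1 l x] by blast
  qed
  show "limiting_coderivative_wrt (poly_C a l1 l) (normal_cone_map (poly_Theta a b l1)) x xs u =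
    {v. \<exists>Q P. Q \<subseteq> active a b l1 l x \<and> positive_idx J lam \<subseteq> P \<and> P \<subseteq> Q \<inter> idx1 l1 \<and>
      (v, - u) \<in> (A_set a Q P \<inter> T_set a (Q \<inter> idx2 l1 l)) \<times> B_set a (Q \<inter> idx1 l1) P}"
  proof (rule set_eqI, unfold limiting_coderivative_normal_cone_map[OF assms(2,3)] mem_Collect_eq,
      intro ex_cong1)
    fix v Q P'
    show "(Q \<subseteq> active a b l1 l x \<and> P' \<in> P_sets a b l1 x xs \<and> C_set a (active a b l1 l x) Q \<noteq> {} \<and>
        P' \<subseteq> Q \<inter> idx1 l1 \<and>
        (v, - u) \<in> (A_set a Q P' \<inter> T_set a (Q \<inter> idx2 l1 l)) \<times> B_set a (Q \<inter> idx1 l1) P') \<longleftrightarrow>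
      (Q \<subseteq> active a b l1 l x \<and> positive_idx J lam \<subseteq> P' \<and> P' \<subseteq> Q \<inter> idx1 l1 \<and>
        (v, - u) \<in> (A_set a Q P' \<inter> T_set a (Q \<inter> idx2 l1 l)) \<times> B_set a (Q \<inter> idx1 l1) P')"
      using C[of Q] P[of Q P'] by blast
  qed
qed

end
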